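(* The Robertson graph (the unique $19$-vertex $4$-regular graph of girth $5$, i.e. the $(4,5)$-cage) admits a total coloring with the five colors $\{0,1,2,3,4\}$ which is not efficient.
   Context: A total coloring assigns colors to vertices and edges so that adjacent vertices, edges sharing an endpoint, and an edge and its endpoints receive different colors. For a connected $k$-regular graph (here $k=4$), a total coloring with colors $\{0,\dots,k\}$ is efficient if for every vertex $v$ the vertices of the closed neighborhood $N[v]$ receive pairwise distinct colors and each vertex color class is an efficient dominating set (an independent set $S$ such that every vertex outside $S$ has exactly one neighbor in $S$). *)

theory Defs
  imports Main "HOL-Library.Extended_Nat"
begin

definition simple_graph :: "'a set \<Rightarrow> 'a set set \<Rightarrow> bool" where
  "simple_graph V E \<longleftrightarrow> finite V \<and> (\<forall>e\<in>E. e \<subseteq> V \<and> card e = 2)"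

definition adjacent :: "'a set set \<Rightarrow> 'a \<Rightarrow> 'a \<Rightarrow> bool" where
  "adjacent E u v \<longleftrightarrow> {u, v} \<in> E"

definition neighborhood :: "'a set set \<Rightarrow> 'a \<Rightarrow> 'a set" where
  "neighborhood E v = {u. adjacent E u v}"

definition closed_neighborhood :: "'a set set \<Rightarrow> 'a \<Rightarrow> 'a set" where
  "closed_neighborhood E v = insert v (neighborhood E v)"

definition regular_graph :: "'a set \<Rightarrow> 'a set set \<Rightarrow> nat \<Rightarrow> bool" where
  "regular_graph V E k \<longleftrightarrow> (\<forall>v\<in>V. card (neighborhood E v) = k)"

definition connected_graph :: "'a set \<Rightarrow> 'a set set \<Rightarrow> bool" where
  "connected_graph V E \<longleftrightarrow> V \<noteq> {} \<and> (\<forall>u\<in>V. \<forall>v\<in>V. (adjacent E)\<^sup>*\<^sup>* u v)"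

(* A cycle is given by the list of its vertices; the last vertex is joined to the first. *)
definition is_cycle :: "'a set set \<Rightarrow> 'a list \<Rightarrow> bool" where
  "is_cycle E xs \<longleftrightarrow> length xs \<ge> 3 \<and> distinct xs \<and>
     (\<forall>i<length xs. adjacent E (xs ! i) (xs ! (Suc i mod length xs)))"

(* Forests have girth \<infinity>. *)
definition girth :: "'a set set \<Rightarrow> enat" where
  "girth E = (INF xs\<in>{xs. is_cycle E xs}. enat (length xs))"

(* A total coloring is a pair of functions, cv on the vertices and ce on the edges;
   values outside V and E are irrelevant. *)
definition total_coloring ::
  "'a set \<Rightarrow> 'a set set \<Rightarrow> 'c set \<Rightarrow> ('a \<Rightarrow> 'c) \<Rightarrow> ('a set \<Rightarrow> 'c) \<Rightarrow> bool" where
  "total_coloring V E C cv ce \<longleftrightarrow>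
     (\<forall>v\<in>V. cv v \<in> C) \<and> (\<forall>e\<in>E. ce e \<in> C) \<and>
     (\<forall>u\<in>V. \<forall>v\<in>V. adjacent E u v \<longrightarrow> cv u \<noteq> cv v) \<and>
     (\<forall>e\<in>E. \<forall>f\<in>E. e \<noteq> f \<and> e \<inter> f \<noteq> {} \<longrightarrow> ce e \<noteq> ce f) \<and>
     (\<forall>e\<in>E. \<forall>v\<in>e. ce e \<noteq> cv v)"

definition independent_vertices :: "'a set set \<Rightarrow> 'a set \<Rightarrow> bool" where
  "independent_vertices E S \<longleftrightarrow> (\<forall>u\<in>S. \<forall>v\<in>S. \<not> adjacent E u v)"

definition efficient_dominating_set :: "'a set \<Rightarrow> 'a set set \<Rightarrow> 'a set \<Rightarrow> bool" where
  "efficient_dominating_set V E S \<longleftrightarrow>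
     S \<subseteq> V \<and> independent_vertices E S \<and> (\<forall>v\<in>V - S. \<exists>!u. u \<in> S \<and> adjacent E u v)"

(* For a total coloring of a connected k-regular graph with colors {0..k}. The condition
   involves the vertex colors only. If it holds, no color class is empty, because every
   closed neighborhood has k + 1 vertices; so ranging over all of {0..k} is harmless. *)
definition efficient_coloring ::
  "'a set \<Rightarrow> 'a set set \<Rightarrow> nat \<Rightarrow> ('a \<Rightarrow> nat) \<Rightarrow> ('a set \<Rightarrow> nat) \<Rightarrow> bool" where
  "efficient_coloring V E k cv ce \<longleftrightarrow>
     (\<forall>v\<in>V. inj_on cv (closed_neighborhood E v)) \<and>
     (\<forall>i\<in>{0..k}. efficient_dominating_set V E {v \<in> V. cv v = i})"

definition robertson_vertices :: "nat set" where
  "robertson_vertices = {0..<19}"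

(* The Robertson graph, drawn as a Hamiltonian cycle 0, 1, ..., 18 together with 19 chords. *)
definition robertson_edges :: "nat set set" where
  "robertson_edges =
     (\<lambda>i. {i, (i + 1) mod 19}) ` {0..<19} \<union>
     {{0, 4}, {0, 15}, {1, 8}, {1, 12}, {2, 6}, {2, 17}, {3, 11}, {3, 14}, {4, 9}, {5, 12},
      {5, 16}, {6, 10}, {7, 14}, {7, 18}, {8, 16}, {9, 13}, {10, 15}, {11, 18}, {13, 17}}"

end

theory Submission
  imports Defs
begin

text \<open>
  The coloring below was found by a computer search. It is not efficient because the vertex \<open>0\<close>
  has the two neighbors \<open>4\<close> and \<open>18\<close> of the same color.
\<close>

definition colored_edges :: "((nat \<times> nat) \<times> nat) list" where
  "colored_edges =
    [((0, 1), 2), ((0, 4), 1), ((0, 15), 3), ((0, 18), 4), ((1, 2), 0), ((1, 8), 4),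
     ((1, 12), 1), ((2, 3), 2), ((2, 6), 3), ((2, 17), 4), ((3, 4), 4), ((3, 11), 3),
     ((3, 14), 1), ((4, 5), 0), ((4, 9), 3), ((5, 6), 2), ((5, 12), 4), ((5, 16), 1),
     ((6, 7), 1), ((6, 10), 4), ((7, 8), 2), ((7, 14), 0), ((7, 18), 3), ((8, 9), 1),
     ((8, 16), 3), ((9, 10), 2), ((9, 13), 0), ((10, 11), 1), ((10, 15), 0), ((11, 12), 2),
     ((11, 18), 0), ((12, 13), 3), ((13, 14), 4), ((13, 17), 2), ((14, 15), 2), ((15, 16), 4),
     ((16, 17), 0), ((17, 18), 1)]"

text \<open>From 19 on the index runs past the list and the value is unspecified; no such number is
  a vertex.\<close>

definition vertex_color :: "nat \<Rightarrow> nat" where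
  "vertex_color v = [0, 3, 1, 0, 2, 3, 0, 4, 0, 4, 3, 4, 0, 1, 3, 1, 2, 3, 2] ! v"

text \<open>Edges are unordered sets, while the keys of the list are pairs with the smaller endpoint
  first; \<open>Min\<close> and \<open>Max\<close> recover the key. On non-edges the value is
  irrelevant.\<close>

definition edge_color :: "nat set \<Rightarrow> nat" where
  "edge_color e = the (map_of colored_edges (Min e, Max e))"

text \<open>Adjacency lists, redundant next to the edge list: with them, statements about neighbors
  become finite checks over rows of four entries.\<close>

definition neighbor_table :: "nat list list" where
  "neighbor_table =
    [[1, 4, 15, 18], [0, 2, 8, 12], [1, 3, 6, 17], [2, 4, 11, 14], [0, 3, 5, 9],
     [4, 6, 12, 16], [2, 5, 7, 10], [6, 8, 14, 18], [1, 7, 9, 16], [4, 8, 10, 13],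
     [6, 9, 11, 15], [3, 10, 12, 18], [1, 5, 11, 13], [9, 12, 14, 17], [3, 7, 13, 15],
     [0, 10, 14, 16], [5, 8, 15, 17], [2, 13, 16, 18], [0, 7, 11, 17]]"

text \<open>Links the description by a Hamiltonian cycle and chords to the explicit list of 38
  edges, on which everything can be evaluated.\<close>

lemma robertson_edges_eq: "robertson_edges = (\<lambda>((a, b), c). {a, b}) ` set colored_edges"
proof -
  have "{0..<19::nat} = {0, 1, 2, 3, 4, 5, 6, 7, 8, 9, 10, 11, 12, 13, 14, 15, 16, 17, 18}"
    by code_simp
  then show ?thesis
    unfolding robertson_edges_def colored_edges_def
    by (simp add: insert_commute flip: numeral_2_eq_2)
qed

lemma colored_edges_ordered: "((a, b), c) \<in> set colored_edges \<Longrightarrow> a < b \<and> b < 19 \<and> c < 5"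
  by (auto simp: colored_edges_def)

text \<open>No key occurs twice, so \<open>map_of\<close> finds every entry; the order
  \<open>a < b\<close> makes \<open>Min\<close> and \<open>Max\<close> return the key
  itself.\<close>

lemma edge_color_eq:
  assumes "((a, b), c) \<in> set colored_edges"
  shows "edge_color {a, b} = c"
proof -
  have "distinct (map fst colored_edges)"
    by code_simp
  then have "map_of colored_edges (a, b) = Some c"
    using assms by simp
  moreover have "a < b"
    using assms colored_edges_ordered by blast
  ultimately show ?thesis
    by (simp add: edge_color_def)
qed

lemma robertson_edgeE:
  assumes "e \<in> robertson_edges"
  obtains a b where "((a, b), edge_color e) \<in> set colored_edges" "e = {a, b}"
proof -
  obtain a b c where "((a, b), c) \<in> set colored_edges" "e = {a, b}"
    using assms unfolding robertson_edges_eq by auto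
  then show thesis
    using that edge_color_eq by simp
qed

lemma adjacent_iff_colored_edges:
  "adjacent robertson_edges u v \<longleftrightarrow>
    (u, v) \<in> fst ` set colored_edges \<or> (v, u) \<in> fst ` set colored_edges"
  unfolding adjacent_def robertson_edges_eq
  by (force simp: doubleton_eq_iff)

text \<open>The two evaluations are the two directions: each listed edge appears in the rows of both
  its endpoints, and each table entry comes from a listed edge. The bound on \<open>u\<close> keeps
  the index inside the table.\<close>

lemma adjacent_iff_neighbor_table:
  "adjacent robertson_edges u v \<longleftrightarrow> u < 19 \<and> v \<in> set (neighbor_table ! u)"
proof -
  have "\<forall>(a, b) \<in> set (map fst colored_edges).
      a < 19 \<and> b < 19 \<and> b \<in> set (neighbor_table ! a) \<and> a \<in> set (neighbor_table ! b)"
    by code_simp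
  moreover have "\<forall>a \<in> {0..<19}. \<forall>b \<in> set (neighbor_table ! a).
      (a, b) \<in> set (map fst colored_edges) \<or> (b, a) \<in> set (map fst colored_edges)"
    by code_simp
  ultimately show ?thesis
    unfolding adjacent_iff_colored_edges by auto
qed

lemma adjacent_robertson_commute: "adjacent robertson_edges u v \<longleftrightarrow> adjacent robertson_edges v u"
  by (simp add: adjacent_def insert_commute)

lemma simple_graph_robertson: "simple_graph robertson_vertices robertson_edges"
proof -
  have "e \<subseteq> robertson_vertices \<and> card e = 2" if e: "e \<in> robertson_edges" for e
  proof -
    obtain a b where "((a, b), edge_color e) \<in> set colored_edges" "e = {a, b}"
      using e by (rule robertson_edgeE)
    then show ?thesis
      using colored_edges_ordered[of a b "edge_color e"] by (auto simp: robertson_vertices_def)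
  qed
  then show ?thesis
    by (auto simp: simple_graph_def robertson_vertices_def)
qed

text \<open>The Hamiltonian path 0, 1, ..., 18 reaches every vertex from 0, and by symmetry any two
  vertices are joined through 0.\<close>

lemma connected_graph_robertson: "connected_graph robertson_vertices robertson_edges"
proof -
  let ?R = "(adjacent robertson_edges)\<^sup>*\<^sup>*"
  have from_0: "?R 0 v" if "v < 19" for v
    using that
  proof (induction v)
    case (Suc v)
    \<comment> \<open>No wrap-around occurs, since \<open>Suc v\<close> is at most 18.\<close>
    have "Suc v mod 19 = Suc v"
      using Suc.prems by simp
    moreover have "{v, (v + 1) mod 19} \<in> robertson_edges"
      unfolding robertson_edges_def using Suc.prems by (intro UnI1 imageI) simp
    ultimately have "adjacent robertson_edges v (Suc v)"
      by (simp add: adjacent_def)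
    then show ?case
      using Suc by (simp add: rtranclp.rtrancl_into_rtrancl)
  qed simp
  have "symp (adjacent robertson_edges)"
    using adjacent_robertson_commute by (blast intro: sympI)
  then have "symp ?R"
    by (rule symp_rtranclp)
  then have "?R u v" if "u < 19" "v < 19" for u v
    using from_0[OF that(1)] from_0[OF that(2)] by (meson rtranclp_trans sympD)
  then show ?thesis
    by (auto simp: connected_graph_def robertson_vertices_def)
qed

lemma regular_graph_robertson: "regular_graph robertson_vertices robertson_edges 4"
proof -
  have "\<forall>v \<in> {0..<19}. card (set (neighbor_table ! v)) = 4"
    by code_simp
  moreover have "neighborhood robertson_edges v = set (neighbor_table ! v)" if "v < 19" for v
    using that adjacent_robertson_commute[of _ v]
    by (simp add: neighborhood_def adjacent_iff_neighbor_table)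
  ultimately show ?thesis
    by (simp add: regular_graph_def robertson_vertices_def)
qed

text \<open>Absence of triangles and 4-cycles, seen from a vertex \<open>v\<close> and two of its
  neighbors. In this local form it is verified by evaluation over the rows of the table.\<close>

lemma robertson_no_short_cycles:
  assumes "adjacent robertson_edges v u" "adjacent robertson_edges v w" "u \<noteq> w"
  shows "\<not> adjacent robertson_edges u w"
    and "adjacent robertson_edges u x \<Longrightarrow> adjacent robertson_edges w x \<Longrightarrow> x = v"
proof -
  have "\<forall>v \<in> {0..<19}. \<forall>u \<in> set (neighbor_table ! v). \<forall>w \<in> set (neighbor_table ! v). u = w \<or>
      w \<notin> set (neighbor_table ! u) \<and>
      (\<forall>x \<in> set (neighbor_table ! u). x \<in> set (neighbor_table ! w) \<longrightarrow> x = v)"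
    by code_simp
  then have "\<not> adjacent robertson_edges u w \<and>
      (\<forall>x. adjacent robertson_edges u x \<longrightarrow> adjacent robertson_edges w x \<longrightarrow> x = v)"
    using assms unfolding adjacent_iff_neighbor_table by (meson atLeastLessThan_iff le0)
  then show "\<not> adjacent robertson_edges u w"
    and "adjacent robertson_edges u x \<Longrightarrow> adjacent robertson_edges w x \<Longrightarrow> x = v"
    by blast+
qed

lemma girth_robertson: "girth robertson_edges = 5"
proof (rule antisym)
  \<comment> \<open>The chord {0, 4} closes the first four edges of the Hamiltonian cycle to a
    5-cycle.\<close>
  let ?c = "[0::nat, 1, 2, 3, 4]"
  have "\<forall>i \<in> {0..<5}. ?c ! i < 19 \<and> ?c ! (Suc i mod 5) \<in> set (neighbor_table ! (?c ! i))"
    by code_simp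
  then have "is_cycle robertson_edges ?c"
    by (simp add: is_cycle_def adjacent_iff_neighbor_table)
  then have "girth robertson_edges \<le> enat (length ?c)"
    unfolding girth_def by (intro INF_lower) simp
  then show "girth robertson_edges \<le> 5"
    by (simp add: numeral_eq_enat eval_nat_numeral)
next
  have "5 \<le> length xs" if cycle: "is_cycle robertson_edges xs" for xs
  proof (rule ccontr)
    have step: "adjacent robertson_edges (xs ! i) (xs ! (Suc i mod length xs))"
      if "i < length xs" for i
      using cycle that by (simp add: is_cycle_def)
    assume "\<not> 5 \<le> length xs"
    then have "length xs = 3 \<or> length xs = 4"
      using cycle by (auto simp: is_cycle_def)
    then show False
    proof
      assume "length xs = 3"
      then obtain a b c where xs: "xs = [a, b, c]"
        by (auto simp: numeral_eq_Suc length_Suc_conv)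
      have "adjacent robertson_edges b c" "adjacent robertson_edges c a"
          "adjacent robertson_edges a b" "b \<noteq> c"
        using step[of 0] step[of 1] step[of 2] cycle by (simp_all add: is_cycle_def xs)
      \<comment> \<open>The distinct neighbors \<open>b\<close> and \<open>c\<close> of
        \<open>a\<close> would be adjacent.\<close>
      then show False
        using robertson_no_short_cycles(1)[of a b c] adjacent_robertson_commute by blast
    next
      assume "length xs = 4"
      then obtain a b c d where xs: "xs = [a, b, c, d]"
        by (auto simp: numeral_eq_Suc length_Suc_conv)
      have "adjacent robertson_edges a b" "adjacent robertson_edges b c"
          "adjacent robertson_edges c d" "adjacent robertson_edges d a" "b \<noteq> d" "c \<noteq> a"
        using step[of 0] step[of 1] step[of 2] step[of 3] cycle
        by (auto simp add: is_cycle_def xs)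
      \<comment> \<open>The distinct neighbors \<open>b\<close> and \<open>d\<close> of
        \<open>a\<close> share the neighbor \<open>c\<close>, which forces
        \<open>c = a\<close>.\<close>
      then show False
        using robertson_no_short_cycles(2)[of a b d c] adjacent_robertson_commute by blast
    qed
  qed
  then show "5 \<le> girth robertson_edges"
    unfolding girth_def by (intro INF_greatest) (auto simp: numeral_eq_enat)
qed

lemma total_coloring_robertson:
  "total_coloring robertson_vertices robertson_edges {0, 1, 2, 3, 4} vertex_color edge_color"
proof -
  have colors: "{0, 1, 2, 3, 4} = {..<5::nat}"
    by auto
  have vertex_range: "\<forall>v \<in> robertson_vertices. vertex_color v \<in> {0, 1, 2, 3, 4}"
    unfolding robertson_vertices_def by code_simp
  have edge_range: "\<forall>e \<in> robertson_edges. edge_color e \<in> {0, 1, 2, 3, 4}"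
    unfolding colors using colored_edges_ordered by (auto elim!: robertson_edgeE)
  \<comment> \<open>One pass over the edges settles both the conflicts between adjacent vertices and
    those between an edge and its endpoints.\<close>
  have local: "\<forall>((a, b), c) \<in> set colored_edges.
      vertex_color a \<noteq> vertex_color b \<and> c \<noteq> vertex_color a \<and> c \<noteq> vertex_color b"
    by code_simp
  then have vertices: "\<forall>u \<in> robertson_vertices. \<forall>v \<in> robertson_vertices.
      adjacent robertson_edges u v \<longrightarrow> vertex_color u \<noteq> vertex_color v"
    by (fastforce simp: adjacent_iff_colored_edges)
  have incident: "\<forall>e \<in> robertson_edges. \<forall>v \<in> e. edge_color e \<noteq> vertex_color v"
  proof
    fix e assume "e \<in> robertson_edges"
    then obtain a b where "((a, b), edge_color e) \<in> set colored_edges" "e = {a, b}"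
      by (rule robertson_edgeE)
    then show "\<forall>v \<in> e. edge_color e \<noteq> vertex_color v"
      using local by fastforce
  qed
  \<comment> \<open>Properness on edges in contrapositive form: each color class of edges is a
    matching.\<close>
  have "\<forall>((a, b), c) \<in> set colored_edges. \<forall>((a', b'), c') \<in> set colored_edges.
      c = c' \<longrightarrow> (a = a' \<and> b = b') \<or> (a \<noteq> a' \<and> a \<noteq> b' \<and> b \<noteq> a' \<and> b \<noteq> b')"
    by code_simp
  then have disjoint: "(a = a' \<and> b = b') \<or> {a, b} \<inter> {a', b'} = {}"
    if "((a, b), c) \<in> set colored_edges" "((a', b'), c) \<in> set colored_edges" for a b a' b' c
    using that by fastforce
  have edges: "\<forall>e \<in> robertson_edges. \<forall>f \<in> robertson_edges.
      e \<noteq> f \<and> e \<inter> f \<noteq> {} \<longrightarrow> edge_color e \<noteq> edge_color f"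
  proof (intro ballI impI notI)
    fix e f
    assume e: "e \<in> robertson_edges" and f: "f \<in> robertson_edges"
      and ef: "e \<noteq> f \<and> e \<inter> f \<noteq> {}" and same: "edge_color e = edge_color f"
    obtain a b where "((a, b), edge_color e) \<in> set colored_edges" "e = {a, b}"
      using e by (rule robertson_edgeE)
    moreover obtain a' b' where "((a', b'), edge_color f) \<in> set colored_edges" "f = {a', b'}"
      using f by (rule robertson_edgeE)
    ultimately show False
      using disjoint[of a b "edge_color e" a' b'] ef same by auto
  qed
  show ?thesis
    unfolding total_coloring_def
    using vertex_range edge_range vertices edges incident by blast
qed

lemma not_efficient_coloring_robertson:
  "\<not> efficient_coloring robertson_vertices robertson_edges 4 vertex_color edge_color"
proof
  assume "efficient_coloring robertson_vertices robertson_edges 4 vertex_color edge_color"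
  then have "inj_on vertex_color (closed_neighborhood robertson_edges 0)"
    by (simp add: efficient_coloring_def robertson_vertices_def)
  \<comment> \<open>A chord joins 4 to 0, and 18 is joined to 0 by the edge closing the Hamiltonian
    cycle; both have color 2.\<close>
  moreover have "4 \<in> closed_neighborhood robertson_edges 0" "18 \<in> closed_neighborhood robertson_edges 0"
    by (simp_all add: closed_neighborhood_def neighborhood_def adjacent_iff_neighbor_table
        neighbor_table_def)
  moreover have "vertex_color 4 = vertex_color 18"
    by code_simp
  ultimately show False
    by (auto dest: inj_onD)
qed

theorem theorem37:
  shows "simple_graph robertson_vertices robertson_edges
    \<and> card robertson_vertices = 19
    \<and> connected_graph robertson_vertices robertson_edges
    \<and> regular_graph robertson_vertices robertson_edges 4
    \<and> girth robertson_edges = 5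
    \<and> (\<exists>(cv :: nat \<Rightarrow> nat) (ce :: nat set \<Rightarrow> nat).
          total_coloring robertson_vertices robertson_edges {0, 1, 2, 3, 4} cv ce
          \<and> \<not> efficient_coloring robertson_vertices robertson_edges 4 cv ce)"
  using simple_graph_robertson connected_graph_robertson regular_graph_robertson
    girth_robertson total_coloring_robertson not_efficient_coloring_robertson
  by (auto simp: robertson_vertices_def)

end
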